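(* For any non-increasing games with activeness $G^g,H^h$, the sum $G^g+H^h$ is non-increasing.
   Context: Let $\mathcal{B}=\{0,1\}$. Define $\mathbb{I}_0=\{\emptyset\}\times\mathcal{B}$ and $\mathbb{I}_n=2^{\mathbb{I}_{n-1}}\times\mathcal{B}$ for $n\ge1$; a game with activeness is an element of $\mathbb{I}=\bigcup_{n\ge0}\mathbb{I}_n$. A pair $(G,g)$ is written $G^g$; elements of $G$ are its options. The sum is defined recursively by $G^g+H^h=(\{G'^{g'}+H^h:G'^{g'}\in G^g\}\cup\{G^g+H'^{h'}:H'^{h'}\in H^h\})^{\max\{g,h\}}$. A game $G^g$ is non-increasing (recursively) if every option $G'^{g'}\in G^g$ is non-increasing and satisfies $g'\le g$. *)

theory Defs
  imports Main "HOL-Library.FSet"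
begin

text \<open>
  Activeness values \<open>0\<close>, \<open>1\<close> are \<^const>\<open>False\<close>, \<^const>\<open>True\<close>, ordered by
  \<^prop>\<open>False < True\<close>.  All the sets \<open>\<I>\<^sub>n\<close> are finite, so option sets are finite sets;
  \<open>UN_games_upto\<close> below shows that the datatype is exactly the union of the stages.
\<close>

datatype game = Game (options: "game fset") (activeness: bool)

fun games_upto :: "nat \<Rightarrow> game set" where
  "games_upto 0 = {Game {||} g | g. True}"
| "games_upto (Suc n) = {Game Gs g | Gs g. fset Gs \<subseteq> games_upto n}"

lemma games_upto_Suc: "games_upto n \<subseteq> games_upto (Suc n)"
proof (induction n)
  case 0
  show ?case by auto
next
  case (Suc n)
  then show ?case by (fastforce simp del: games_upto.simps(1))
qed

lemma games_upto_mono: "m \<le> n \<Longrightarrow> games_upto m \<subseteq> games_upto n"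
  by (rule lift_Suc_mono_le[of games_upto]) (rule games_upto_Suc)

lemma UN_games_upto: "(\<Union>n. games_upto n) = UNIV"
proof -
  have "\<exists>n. G \<in> games_upto n" for G
  proof (induction G)
    case (Game Gs g)
    then obtain f where f: "\<And>G. G \<in> fset Gs \<Longrightarrow> G \<in> games_upto (f G)" by metis
    define n where "n = Max (insert 0 (f ` fset Gs))"
    have "f G \<le> n" if "G \<in> fset Gs" for G using that by (auto simp: n_def)
    then have "fset Gs \<subseteq> games_upto n" using f games_upto_mono by blast
    then have "Game Gs g \<in> games_upto (Suc n)" by auto
    then show ?case by blast
  qed
  then show ?thesis by blast
qed

lemma size_option: "G' |\<in>| options G \<Longrightarrow> size G' < size G"
proof (cases G)
  case (Game Gs g)
  assume "G' |\<in>| options G"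
  then have "Suc (size G') \<le> (\<Sum>G\<in>fset Gs. Suc (size G))"
    using Game by (intro member_le_sum[where f = "\<lambda>G. Suc (size G)"]) auto
  then show ?thesis using Game by (simp add: size_fset_overloaded_simps)
qed

instantiation game :: plus
begin

function plus_game :: "game \<Rightarrow> game \<Rightarrow> game" where
  "plus_game G H =
     Game ((\<lambda>G'. plus_game G' H) |`| options G |\<union>| (\<lambda>H'. plus_game G H') |`| options H)
       (max (activeness G) (activeness H))"
  by auto
termination
  by (relation "measure (\<lambda>(G, H). size G + size H)") (auto dest: size_option)

instance ..

end

declare plus_game.simps [simp del]

function non_increasing :: "game \<Rightarrow> bool" where
  "non_increasing G \<longleftrightarrow>
     (\<forall>G' \<in> fset (options G). non_increasing G' \<and> activeness G' \<le> activeness G)"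
  by auto
termination
  by (relation "measure size") (auto dest: size_option)

declare non_increasing.simps [simp del]

end

theory Submission imports Defs begin

text \<open>Induction on the pair of summands. By \<open>options_plus\<close>, an option of the sum
  moves in exactly one summand, so it is a sum of games that are again non-increasing
  (\<open>non_increasing_option\<close>) and the induction hypothesis applies. Its activeness cannot
  exceed that of the sum, since max is monotone in each argument
  (\<open>activeness_plus\<close>).\<close>

lemma activeness_plus: "activeness (G + H) = max (activeness G) (activeness H)"
  \<comment> \<open>Unfolded just once: as a simp rule this equation would loop.\<close>
  by (subst plus_game.simps) simp

lemma options_plus:
  "options (G + H) = (\<lambda>G'. G' + H) |`| options G |\<union>| (\<lambda>H'. G + H') |`| options H"
  by (subst plus_game.simps) simp

lemma non_increasing_option:
  assumes "non_increasing G" and "G' |\<in>| options G"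
  shows "non_increasing G'" and "activeness G' \<le> activeness G"
  using assms non_increasing.simps[of G] by blast+

theorem theorem4p2:
  fixes G H :: game
  assumes "non_increasing G" and "non_increasing H"
  shows "non_increasing (G + H)"
  using assms
proof (induction G H rule: plus_game.induct)
  case (1 G H)
  have "non_increasing K \<and> activeness K \<le> activeness (G + H)" if "K |\<in>| options (G + H)" for K
  proof -
    from that consider
        (left) G' where "G' |\<in>| options G" "K = G' + H"
      | (right) H' where "H' |\<in>| options H" "K = G + H'"
      by (auto simp: options_plus)
    then show ?thesis
    proof cases
      case left
      \<comment> \<open>Here g' <= g gives max(g', h) <= max(g, h).\<close>
      then show ?thesis
        using "1.IH"(1) "1.prems" non_increasing_option[of G G']
        by (simp add: activeness_plus max_def)
    next
      case right
      then show ?thesis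
        using "1.IH"(2) "1.prems" non_increasing_option[of H H']
        by (simp add: activeness_plus max_def)
    qed
  qed
  then show ?case
    by (subst non_increasing.simps) blast
qed

end
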